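(* For every real number $y$, the Poisson generating functions of the Padovan hyperbolic spinors $\psi_n$ and of the Perrin hyperbolic spinors $\phi_n$ are $$e^{-y}\sum_{n=0}^\infty \psi_n\frac{y^n}{n!}=e^{-y}A\sigma_1e^{\alpha y}+e^{-y}B\sigma_2e^{\beta y}+e^{-y}C\sigma_3e^{\gamma y},$$ $$e^{-y}\sum_{n=0}^\infty \phi_n\frac{y^n}{n!}=e^{-y}Ae^{\alpha y}+e^{-y}Be^{\beta y}+e^{-y}Ce^{\gamma y}.$$
   Context: Hyperbolic numbers are expressions $a+bj$ with $a,b\in\mathbb{R}$ and a unit $j\notin\mathbb{R}$, $j^2=1$; they form a commutative ring. A hyperbolic spinor is a column vector with two hyperbolic number components. Since complex coefficients occur in the formulas, the identities are read for column vectors over the commutative ring $\{a+bj: a,b\in\mathbb{C}\}$, $j^2=1$, $j$ commuting with $\mathbb{C}$; series converge coefficientwise. The Padovan numbers $(P_n)_{n\ge 0}$ are defined by $P_0=P_1=P_2=1$ and $P_{n+3}=P_{n+1}+P_n$ for $n\ge0$. The Perrin numbers $(R_n)_{n\ge 0}$ are defined by $R_0=3$, $R_1=0$, $R_2=2$ and $R_{n+3}=R_{n+1}+R_n$ for $n\ge 0$. The $n$-th Padovan hyperbolic spinor and the $n$-th Perrin hyperbolic spinor are $$\psi_n=\begin{bmatrix}P_n+P_{n+3}j\\ -P_{n+1}+P_{n+2}j\end{bmatrix},\qquad \phi_n=\begin{bmatrix}R_n+R_{n+3}j\\ -R_{n+1}+R_{n+2}j\end{bmatrix}.$$ The Poisson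 generating function of a sequence is its exponential generating function in $y$ multiplied by $e^{-y}$. $\alpha,\beta,\gamma$ are the three (distinct) complex roots of $x^3-x-1=0$, with $\alpha$ the real one and $\beta,\gamma$ the complex conjugate pair ($\beta$ having positive imaginary part), and $$\sigma_1=\frac{(\beta-1)(\gamma-1)}{(\alpha-\beta)(\alpha-\gamma)},\quad \sigma_2=\frac{(\alpha-1)(\gamma-1)}{(\beta-\alpha)(\beta-\gamma)},\quad \sigma_3=\frac{(\alpha-1)(\beta-1)}{(\gamma-\alpha)(\gamma-\beta)}.$$ Moreover $$A=\begin{bmatrix}1+\alpha^3 j\\ \alpha(-1+\alpha j)\end{bmatrix},\quad B=\begin{bmatrix}1+\beta^3 j\\ \beta(-1+\beta j)\end{bmatrix},\quad C=\begin{bmatrix}1+\gamma^3 j\\ \gamma(-1+\gamma j)\end{bmatrix}.$$ *)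

theory Defs
  imports "HOL-Analysis.Analysis"
begin

text \<open>
  \<open>Hyp a b\<close> encodes \<open>a + b j\<close>, where \<open>j\<^sup>2 = 1\<close> and \<open>j\<close> commutes with the coefficients.
  Hyperbolic numbers are the type \<open>real hyp\<close>; \<open>complex hyp\<close> is the ring with complex coefficients,
  and \<open>map_hyp of_real\<close> is the inclusion of the former into the latter.
\<close>

datatype 'a hyp = Hyp (hyp_fst: 'a) (hyp_snd: 'a)

lemma hyp_eq_iff: "x = y \<longleftrightarrow> hyp_fst x = hyp_fst y \<and> hyp_snd x = hyp_snd y"
  by (cases x; cases y) simp

instantiation hyp :: (ab_group_add) ab_group_add
begin

definition "0 = Hyp 0 0"
definition "x + y = Hyp (hyp_fst x + hyp_fst y) (hyp_snd x + hyp_snd y)"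
definition "- x = Hyp (- hyp_fst x) (- hyp_snd x)"
definition "x - y = Hyp (hyp_fst x - hyp_fst y) (hyp_snd x - hyp_snd y)"

instance
  by standard (auto simp: zero_hyp_def plus_hyp_def uminus_hyp_def minus_hyp_def algebra_simps)

end

instantiation hyp :: (comm_ring_1) comm_ring_1
begin

definition "1 = Hyp 1 0"
definition "x * y = Hyp (hyp_fst x * hyp_fst y + hyp_snd x * hyp_snd y)
                        (hyp_fst x * hyp_snd y + hyp_snd x * hyp_fst y)"

instance
  by standard
    (auto simp: zero_hyp_def one_hyp_def plus_hyp_def times_hyp_def algebra_simps)

end

definition hyp_of :: "'a::zero \<Rightarrow> 'a hyp" where
  "hyp_of a = Hyp a 0"

definition hyp_j :: "'a::zero_neq_one hyp" where
  "hyp_j = Hyp 0 1"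

lemma hyp_j_square: "hyp_j * hyp_j = (1 :: 'a::comm_ring_1 hyp)"
  by (simp add: hyp_j_def one_hyp_def times_hyp_def)

lemma Hyp_eq: "Hyp a b = hyp_of a + hyp_of b * (hyp_j :: 'a::comm_ring_1 hyp)"
  by (simp add: hyp_j_def hyp_of_def plus_hyp_def times_hyp_def)

instantiation hyp :: (real_vector) real_vector
begin

definition "r *\<^sub>R x = Hyp (r *\<^sub>R hyp_fst x) (r *\<^sub>R hyp_snd x)"

instance
  by standard (auto simp: scaleR_hyp_def plus_hyp_def algebra_simps)

end

text \<open>
  The norm serves only to provide the topology of coefficientwise convergence;
  see \<open>tendsto_hyp_iff\<close> and \<open>sums_hyp_spinor_iff\<close> below.
\<close>

instantiation hyp :: (real_normed_vector) real_normed_vector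
begin

definition "norm x = norm (hyp_fst x) + norm (hyp_snd x)"
definition "sgn (x :: 'a hyp) = x /\<^sub>R norm x"
definition "dist (x :: 'a hyp) y = norm (x - y)"
definition [code del]:
  "(uniformity :: ('a hyp \<times> 'a hyp) filter) = (INF e\<in>{0 <..}. principal {(x, y). dist x y < e})"
definition [code del]:
  "open (U :: 'a hyp set) \<longleftrightarrow> (\<forall>x\<in>U. eventually (\<lambda>(x', y). x' = x \<longrightarrow> y \<in> U) uniformity)"

instance
proof
  fix x y :: "'a hyp" and r :: real
  show "norm (x + y) \<le> norm x + norm y"
    using norm_triangle_ineq[of "hyp_fst x" "hyp_fst y"]
      norm_triangle_ineq[of "hyp_snd x" "hyp_snd y"]
    by (simp add: norm_hyp_def plus_hyp_def)
  show "(norm x = 0) = (x = 0)"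
    by (cases x) (simp add: norm_hyp_def zero_hyp_def add_nonneg_eq_0_iff)
qed (auto simp: scaleR_hyp_def norm_hyp_def plus_hyp_def sgn_hyp_def dist_hyp_def
      uniformity_hyp_def open_hyp_def algebra_simps)

end

lemma bounded_linear_hyp_fst: "bounded_linear hyp_fst"
  by (rule bounded_linear_intro[where K = 1])
    (auto simp: plus_hyp_def scaleR_hyp_def norm_hyp_def)

lemma bounded_linear_hyp_snd: "bounded_linear hyp_snd"
  by (rule bounded_linear_intro[where K = 1])
    (auto simp: plus_hyp_def scaleR_hyp_def norm_hyp_def)

lemma tendsto_hyp_iff:
  "(f \<longlongrightarrow> l) F \<longleftrightarrow>
     ((\<lambda>x. hyp_fst (f x)) \<longlongrightarrow> hyp_fst l) F \<and> ((\<lambda>x. hyp_snd (f x)) \<longlongrightarrow> hyp_snd l) F"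
  (is "?L \<longleftrightarrow> ?R")
proof
  assume ?L
  then show ?R
    by (auto intro: bounded_linear.tendsto[OF bounded_linear_hyp_fst]
        bounded_linear.tendsto[OF bounded_linear_hyp_snd])
next
  assume R: ?R
  have "((\<lambda>x. norm (hyp_fst (f x) - hyp_fst l) + norm (hyp_snd (f x) - hyp_snd l)) \<longlongrightarrow> 0 + 0) F"
    using R by (intro tendsto_add tendsto_norm_zero) (auto simp: LIM_zero_iff)
  then show ?L
    by (simp add: tendsto_dist_iff[of f] dist_hyp_def norm_hyp_def minus_hyp_def)
qed

lemma hyp_fst_sum: "hyp_fst (sum f A) = (\<Sum>x\<in>A. hyp_fst (f x))"
  by (induction A rule: infinite_finite_induct) (auto simp: zero_hyp_def plus_hyp_def)

lemma hyp_snd_sum: "hyp_snd (sum f A) = (\<Sum>x\<in>A. hyp_snd (f x))"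
  by (induction A rule: infinite_finite_induct) (auto simp: zero_hyp_def plus_hyp_def)

lemma sums_hyp_spinor_iff:
  fixes f :: "nat \<Rightarrow> ('a::real_normed_vector hyp) ^ 'n::finite"
  shows "f sums s \<longleftrightarrow>
    (\<forall>i. (\<lambda>n. hyp_fst (f n $ i)) sums hyp_fst (s $ i) \<and> (\<lambda>n. hyp_snd (f n $ i)) sums hyp_snd (s $ i))"
proof -
  have "f sums s \<longleftrightarrow> (\<forall>i. (\<lambda>n. (\<Sum>k<n. f k) $ i) \<longlonglongrightarrow> s $ i)"
    unfolding sums_def by (rule iffI, rule allI, erule tendsto_vec_nth, rule vec_tendstoI, erule spec)
  then show ?thesis
    by (simp add: tendsto_hyp_iff hyp_fst_sum hyp_snd_sum sums_def)
qed

fun padovan :: "nat \<Rightarrow> nat" where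
  "padovan 0 = 1"
| "padovan (Suc 0) = 1"
| "padovan (Suc (Suc 0)) = 1"
| "padovan (Suc (Suc (Suc n))) = padovan (Suc n) + padovan n"

fun perrin :: "nat \<Rightarrow> nat" where
  "perrin 0 = 3"
| "perrin (Suc 0) = 0"
| "perrin (Suc (Suc 0)) = 2"
| "perrin (Suc (Suc (Suc n))) = perrin (Suc n) + perrin n"

type_synonym hyp_spinor = "(real hyp) ^ 2"

definition padovan_spinor :: "nat \<Rightarrow> hyp_spinor" where
  "padovan_spinor n = vector
     [Hyp (real (padovan n)) (real (padovan (n + 3))),
      Hyp (- real (padovan (n + 1))) (real (padovan (n + 2)))]"

definition perrin_spinor :: "nat \<Rightarrow> hyp_spinor" where
  "perrin_spinor n = vector
     [Hyp (real (perrin n)) (real (perrin (n + 3))),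
      Hyp (- real (perrin (n + 1))) (real (perrin (n + 2)))]"

definition complexify :: "hyp_spinor \<Rightarrow> (complex hyp) ^ 2" where
  "complexify v = (\<chi> i. map_hyp complex_of_real (v $ i))"

definition cscale :: "complex \<Rightarrow> (complex hyp) ^ 2 \<Rightarrow> (complex hyp) ^ 2" (infixr "*\<^sub>H" 75) where
  "c *\<^sub>H v = hyp_of c *s v"

definition egf_term :: "(nat \<Rightarrow> hyp_spinor) \<Rightarrow> real \<Rightarrow> nat \<Rightarrow> (complex hyp) ^ 2" where
  "egf_term f y n = complex_of_real (y ^ n / fact n) *\<^sub>H complexify (f n)"

definition poisson_gf :: "(nat \<Rightarrow> hyp_spinor) \<Rightarrow> real \<Rightarrow> (complex hyp) ^ 2" where
  "poisson_gf f y = complex_of_real (exp (- y)) *\<^sub>H (\<Sum>n. egf_term f y n)"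

text \<open>
  For the roots \<open>\<alpha>\<close>, \<open>\<beta>\<close>, \<open>\<gamma>\<close> of \<open>x\<^sup>3 - x - 1\<close>, the coefficients \<open>\<sigma>\<^sub>1\<close>, \<open>\<sigma>\<^sub>2\<close>, \<open>\<sigma>\<^sub>3\<close> are
  \<open>padovan_coeff \<alpha> \<beta> \<gamma>\<close>, \<open>padovan_coeff \<beta> \<alpha> \<gamma>\<close>, \<open>padovan_coeff \<gamma> \<alpha> \<beta>\<close>, and the
  vectors \<open>A\<close>, \<open>B\<close>, \<open>C\<close> are \<open>root_spinor \<alpha>\<close>, \<open>root_spinor \<beta>\<close>, \<open>root_spinor \<gamma>\<close>.
\<close>

definition padovan_coeff :: "complex \<Rightarrow> complex \<Rightarrow> complex \<Rightarrow> complex" where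
  "padovan_coeff a b c = ((b - 1) * (c - 1)) / ((a - b) * (a - c))"

definition root_spinor :: "complex \<Rightarrow> (complex hyp) ^ 2" where
  "root_spinor x = vector [Hyp 1 (x ^ 3), hyp_of x * Hyp (- 1) x]"

end

theory Submission
  imports Defs
begin

text \<open>
  Both sequences have a Binet form \<open>c\<^sub>1 \<alpha>\<^sup>n + c\<^sub>2 \<beta>\<^sup>n + c\<^sub>3 \<gamma>\<^sup>n\<close>. For the Padovan numbers,
  \<open>\<sigma>\<^sub>1\<close>, \<open>\<sigma>\<^sub>2\<close>, \<open>\<sigma>\<^sub>3\<close> are the values at \<open>1\<close> of the Lagrange basis polynomials for the nodes
  \<open>\<alpha>\<close>, \<open>\<beta>\<close>, \<open>\<gamma>\<close>, so they reproduce \<open>1\<^sup>n = 1\<close> for \<open>n \<le> 2\<close>; for the Perrin numbers, the three initial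
  power sums come from Vieta's formulas. The recurrence does the rest. The shifts by \<open>1, 2, 3\<close> in
  the spinors multiply the coefficients by powers of the roots, which are the entries of
  \<open>A\<close>, \<open>B\<close>, \<open>C\<close>, and the exponential series are summed coefficientwise.
\<close>

text \<open>The Padovan and Perrin spinors share this shape, so one computation from a three-term
  Binet form serves both.\<close>

definition sequence_spinor :: "(nat \<Rightarrow> nat) \<Rightarrow> nat \<Rightarrow> hyp_spinor" where
  "sequence_spinor f n = vector
     [Hyp (real (f n)) (real (f (n + 3))), Hyp (- real (f (n + 1))) (real (f (n + 2)))]"

lemma padovan_spinor_eq: "padovan_spinor = sequence_spinor padovan"
  by (simp add: fun_eq_iff padovan_spinor_def sequence_spinor_def)

lemma perrin_spinor_eq: "perrin_spinor = sequence_spinor perrin"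
  by (simp add: fun_eq_iff perrin_spinor_def sequence_spinor_def)

lemma hyp_fst_cscale [simp]: "hyp_fst ((c *\<^sub>H v) $ i) = c * hyp_fst (v $ i)"
  by (simp add: cscale_def hyp_of_def times_hyp_def)

lemma hyp_snd_cscale [simp]: "hyp_snd ((c *\<^sub>H v) $ i) = c * hyp_snd (v $ i)"
  by (simp add: cscale_def hyp_of_def times_hyp_def)

lemma cscale_cscale: "a *\<^sub>H b *\<^sub>H v = (a * b) *\<^sub>H v"
  by (simp add: vec_eq_iff hyp_eq_iff mult.assoc)

lemma cscale_add: "c *\<^sub>H (v + w) = c *\<^sub>H v + c *\<^sub>H w"
  by (simp add: vec_eq_iff hyp_eq_iff plus_hyp_def algebra_simps)

lemma sums_cscale:
  assumes "f sums s"
  shows "(\<lambda>n. f n *\<^sub>H v) sums (s *\<^sub>H v)"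
  using assms by (simp add: sums_hyp_spinor_iff sums_mult2)

text \<open>Shifting the index by 0, 3, 1, 2 multiplies \<open>x ^ n\<close> by \<open>1\<close>,
  \<open>x ^ 3\<close>, \<open>x\<close>, \<open>x ^ 2\<close>, which up to sign are the entries of
  \<open>root_spinor x\<close>. The scalars are left in the form of the terms in
  \<open>exp_converges\<close>.\<close>

lemma egf_term_sequence_spinor:
  fixes a b c x z w :: complex
  assumes f: "\<And>n. of_nat (f n) = a * x ^ n + b * z ^ n + c * w ^ n"
  shows "egf_term (sequence_spinor f) y n =
    (a * ((x * y) ^ n /\<^sub>R fact n)) *\<^sub>H root_spinor x +
    (b * ((z * y) ^ n /\<^sub>R fact n)) *\<^sub>H root_spinor z +
    (c * ((w * y) ^ n /\<^sub>R fact n)) *\<^sub>H root_spinor w"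
  by (simp add: vec_eq_iff hyp_eq_iff forall_2 plus_hyp_def egf_term_def complexify_def
      sequence_spinor_def root_spinor_def hyp_of_def times_hyp_def f hyp.map_sel
      power_mult_distrib scaleR_conv_of_real power_add power2_eq_square power3_eq_cube divide_simps)
     (simp add: algebra_simps)

lemma egf_sequence_spinor_sums:
  fixes a b c x z w :: complex
  assumes f: "\<And>n. of_nat (f n) = a * x ^ n + b * z ^ n + c * w ^ n"
  shows "egf_term (sequence_spinor f) y sums
    ((a * exp (x * y)) *\<^sub>H root_spinor x + (b * exp (z * y)) *\<^sub>H root_spinor z +
     (c * exp (w * y)) *\<^sub>H root_spinor w)"
  unfolding egf_term_sequence_spinor[OF f]
  by (intro sums_add sums_cscale sums_mult exp_converges)

lemma poisson_gf_sequence_spinor: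
  fixes a b c x z w :: complex
  assumes f: "\<And>n. of_nat (f n) = a * x ^ n + b * z ^ n + c * w ^ n"
  shows "poisson_gf (sequence_spinor f) y =
    (exp (- y) * a * exp (x * y)) *\<^sub>H root_spinor x +
    (exp (- y) * b * exp (z * y)) *\<^sub>H root_spinor z +
    (exp (- y) * c * exp (w * y)) *\<^sub>H root_spinor w"
  unfolding poisson_gf_def egf_sequence_spinor_sums[of f, OF f, THEN sums_unique, symmetric]
  by (simp add: cscale_add cscale_cscale mult.assoc flip: exp_of_real)

text \<open>Subtract the cubic equations pairwise and cancel the nonzero differences of roots;
  repeating this on the resulting quadratics gives the sum.\<close>

lemma cubic_vieta:
  fixes a b c :: "'a::field"
  assumes "a \<noteq> b" "a \<noteq> c" "b \<noteq> c"
    and a: "a ^ 3 - a - 1 = 0" and b: "b ^ 3 - b - 1 = 0" and c: "c ^ 3 - c - 1 = 0"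
  shows "a + b + c = 0" "a * b + a * c + b * c = -1"
proof -
  have "(a - b) * (a * a + a * b + b * b - 1) = 0"
    using a b by algebra
  then have ab: "a * a + a * b + b * b - 1 = 0"
    using \<open>a \<noteq> b\<close> by simp
  have "(a - c) * (a * a + a * c + c * c - 1) = 0"
    using a c by algebra
  then have "a * a + a * c + c * c - 1 = 0"
    using \<open>a \<noteq> c\<close> by simp
  with ab have "(b - c) * (a + b + c) = 0"
    by algebra
  then show s: "a + b + c = 0"
    using \<open>b \<noteq> c\<close> by simp
  \<comment> \<open>With \<open>c = - a - b\<close> the left side is
    \<open>- (a * a + a * b + b * b)\<close>.\<close>
  show "a * b + a * c + b * c = -1"
    using s ab by algebra
qed

lemma cubic_root_power:
  fixes x :: "'a::comm_ring_1"
  assumes "x ^ 3 - x - 1 = 0"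
  shows "x ^ Suc (Suc (Suc n)) = x ^ Suc n + x ^ n"
proof -
  have "x ^ 3 = x + 1"
    using assms by (simp add: algebra_simps)
  then have "x ^ n * x ^ 3 = x ^ n * (x + 1)"
    by simp
  then show ?thesis
    by (simp add: power3_eq_cube algebra_simps)
qed

lemma padovan_binet:
  fixes a b c :: complex
  assumes d: "a \<noteq> b" "a \<noteq> c" "b \<noteq> c"
    and roots: "a ^ 3 - a - 1 = 0" "b ^ 3 - b - 1 = 0" "c ^ 3 - c - 1 = 0"
  shows "of_nat (padovan n) =
    padovan_coeff a b c * a ^ n + padovan_coeff b a c * b ^ n + padovan_coeff c a b * c ^ n"
proof -
  \<comment> \<open>Up to sign, \<open>D\<close> is the Vandermonde determinant of the roots. As a
    common denominator it turns the initial values into polynomial identities.\<close>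
  define D where "D = (a - b) * (a - c) * (b - c)"
  have "D \<noteq> 0"
    using d by (simp add: D_def)
  have coeff1: "padovan_coeff a b c = (b - 1) * (c - 1) * (b - c) / D"
    unfolding padovan_coeff_def D_def
    by (subst frac_eq_eq, use d in simp, use d in simp, algebra)
  \<comment> \<open>The sign comes from \<open>b - a\<close>, which reverses one factor of
    \<open>D\<close>; for \<open>c\<close> two factors are reversed.\<close>
  have coeff2: "padovan_coeff b a c = - ((a - 1) * (c - 1) * (a - c)) / D"
    unfolding padovan_coeff_def D_def
    by (subst frac_eq_eq, use d in simp, use d in simp, algebra)
  have coeff3: "padovan_coeff c a b = (a - 1) * (b - 1) * (a - b) / D"
    unfolding padovan_coeff_def D_def
    by (subst frac_eq_eq, use d in simp, use d in simp, algebra)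
  have init:
    "1 = padovan_coeff a b c * p + padovan_coeff b a c * q + padovan_coeff c a b * r"
    if "D = (b - 1) * (c - 1) * (b - c) * p - (a - 1) * (c - 1) * (a - c) * q
      + (a - 1) * (b - 1) * (a - b) * r" for p q r
    using that \<open>D \<noteq> 0\<close> unfolding coeff1 coeff2 coeff3 by (simp add: divide_simps)
  show ?thesis
  proof (induction n rule: padovan.induct)
    case 1
    have "D = (b - 1) * (c - 1) * (b - c) * 1 - (a - 1) * (c - 1) * (a - c) * 1
        + (a - 1) * (b - 1) * (a - b) * 1"
      unfolding D_def by algebra
    from init[OF this] show ?case
      by simp
  next
    case 2
    have "D = (b - 1) * (c - 1) * (b - c) * a - (a - 1) * (c - 1) * (a - c) * b
        + (a - 1) * (b - 1) * (a - b) * c"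
      unfolding D_def by algebra
    from init[OF this] show ?case
      by simp
  next
    case 3
    have "D = (b - 1) * (c - 1) * (b - c) * (a * a) - (a - 1) * (c - 1) * (a - c) * (b * b)
        + (a - 1) * (b - 1) * (a - b) * (c * c)"
      unfolding D_def by algebra
    from init[OF this] show ?case
      by simp
  next
    case (4 n)
    show ?case
      unfolding padovan.simps of_nat_add 4 roots[THEN cubic_root_power] by (simp only: algebra_simps)
  qed
qed

lemma perrin_binet:
  fixes a b c :: complex
  assumes d: "a \<noteq> b" "a \<noteq> c" "b \<noteq> c"
    and roots: "a ^ 3 - a - 1 = 0" "b ^ 3 - b - 1 = 0" "c ^ 3 - c - 1 = 0"
  shows "of_nat (perrin n) = a ^ n + b ^ n + c ^ n"
proof (induction n rule: perrin.induct)
  case 1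
  show ?case by simp
next
  case 2
  show ?case using cubic_vieta[OF d roots] by simp
next
  case 3
  \<comment> \<open>This is the square of the sum minus twice the sum of pairwise products,
    \<open>0 - 2 * (-1)\<close>.\<close>
  have "a * a + b * b + c * c = 2"
    using cubic_vieta[OF d roots] by algebra
  then show ?case by simp
next
  case (4 n)
  show ?case
    unfolding perrin.simps of_nat_add 4 roots[THEN cubic_root_power] by (simp only: ac_simps)
qed

theorem theorem16:
  fixes \<alpha> \<beta> \<gamma> :: complex and y :: real
  assumes roots: "{x :: complex. x ^ 3 - x - 1 = 0} = {\<alpha>, \<beta>, \<gamma>}"
    and real_root: "\<alpha> \<in> \<real>"
    and conj_roots: "\<gamma> = cnj \<beta>" "Im \<beta> > 0"
  shows "summable (egf_term padovan_spinor y) \<and>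
         poisson_gf padovan_spinor y =
           (exp (- y) * padovan_coeff \<alpha> \<beta> \<gamma> * exp (\<alpha> * y)) *\<^sub>H root_spinor \<alpha> +
           (exp (- y) * padovan_coeff \<beta> \<alpha> \<gamma> * exp (\<beta> * y)) *\<^sub>H root_spinor \<beta> +
           (exp (- y) * padovan_coeff \<gamma> \<alpha> \<beta> * exp (\<gamma> * y)) *\<^sub>H root_spinor \<gamma> \<and>
         summable (egf_term perrin_spinor y) \<and>
         poisson_gf perrin_spinor y =
           (exp (- y) * exp (\<alpha> * y)) *\<^sub>H root_spinor \<alpha> +
           (exp (- y) * exp (\<beta> * y)) *\<^sub>H root_spinor \<beta> +
           (exp (- y) * exp (\<gamma> * y)) *\<^sub>H root_spinor \<gamma>"
proof -
  \<comment> \<open>The imaginary parts of \<alpha>, \<beta>, \<gamma> are zero, positive and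
    negative.\<close>
  have d: "\<alpha> \<noteq> \<beta>" "\<alpha> \<noteq> \<gamma>" "\<beta> \<noteq> \<gamma>"
    using real_root conj_roots by (auto simp: complex_is_Real_iff complex_eq_iff)
  have r: "\<alpha> ^ 3 - \<alpha> - 1 = 0" "\<beta> ^ 3 - \<beta> - 1 = 0" "\<gamma> ^ 3 - \<gamma> - 1 = 0"
    using roots by blast+
  note pad = padovan_binet[OF d r]
  \<comment> \<open>The explicit factors \<open>1\<close> match the coefficients in the general
    Binet hypothesis.\<close>
  have per: "of_nat (perrin n) = 1 * \<alpha> ^ n + 1 * \<beta> ^ n + 1 * \<gamma> ^ n" for n
    using perrin_binet[OF d r] by simp
  have "summable (egf_term padovan_spinor y)" "summable (egf_term perrin_spinor y)"
    unfolding padovan_spinor_eq perrin_spinor_eq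
    using egf_sequence_spinor_sums[of padovan, OF pad] egf_sequence_spinor_sums[of perrin, OF per]
    by (blast intro: sums_summable)+
  then show ?thesis
    using poisson_gf_sequence_spinor[of padovan, OF pad, of y]
      poisson_gf_sequence_spinor[of perrin, OF per, of y]
    by (simp add: padovan_spinor_eq perrin_spinor_eq flip: exp_of_real)
qed

end
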